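(* Let $Y$ be a Banach space, $\Phi:Y\to Y$ Lipschitz continuous, $\mathcal{A}\subset Y$ a compact set with $\Phi(\mathcal{A})=\mathcal{A}$, $R:Y\to\mathbb{R}^k$ an observation map that is one-to-one on $\mathcal{A}$, $A_k=R(\mathcal{A})$, and let $E:\mathbb{R}^k\to Y$ and the core dynamical system $\varphi=R\circ\Phi\circ E:\mathbb{R}^k\to\mathbb{R}^k$ be as defined in the context. Let $u^*\in\mathcal{A}$ be a steady state of $\Phi$ with $\mathcal{W}^u_\Phi(u^* )\subset\mathcal{A}$, let $\mathcal{W}^u_{\Phi,loc}(u^* )\subset\mathcal{A}$ be a local unstable manifold of $u^*$, and put $p=R(u^* )$ and $W^u_{loc}(p)=R\big(\overline{\mathcal{W}^u_{\Phi,loc}(u^* )}\big)$. For a compact set $C\subset\mathbb{R}^k$ let $A_C=\bigcap_{j\ge 0}\varphi^j(C)$ denote the global attractor relative to $C$. (a) Let $C\subset A_k$ be a compact neighborhood of $p$ in $A_k$ with $W^u_{loc}(p)\subset C$. Then $$W^u_{loc}(p)\subset A_C .$$ (b) Suppose that $\overline{\mathcal{W}^u_{\Phi,loc}(u^* )}$ is a compact attracting set of $\Phi$ with basin of attraction $\mathcal{U}\supset\overline{\mathcal{W}^u_{\Phi,loc}(u^* )}$. Let $C\subset\mathbb{R}^k$ be compact such that $W^u_{loc}(p)\subset C\subset A_k$ and $E(C)\subset\mathcal{U}$. Then $$W^u_{loc}(p)=A_C .$$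
   Context: Observation map: $R$ is either a bounded linear map $R:Y\to\mathbb{R}^k$, or a delay observation map $R(u)=(f(u),f(\Phi(u)),\dots,f(\Phi^{k-1}(u)))^T$ with $f:Y\to\mathbb{R}$ Lipschitz (or the analogous map built from several Lipschitz observables $f_1,\dots,f_q$), chosen so that $R$ is one-to-one on $\mathcal{A}$. Thus $R$ is continuous and restricts to a homeomorphism from $\mathcal{A}$ onto $A_k=R(\mathcal{A})$. Core dynamical system: let $\widetilde E:A_k\to Y$ be the continuous map with $(\widetilde E\circ R)(u)=u$ for all $u\in\mathcal{A}$ and $(R\circ\widetilde E)(x)=x$ for all $x\in A_k$; let $E:\mathbb{R}^k\to Y$ be a (fixed) continuous extension of $\widetilde E$, i.e. $E|_{A_k}=\widetilde E$ (it exists by Dugundji's extension theorem). The core dynamical system is the continuous map $\varphi=R\circ\Phi\circ E:\mathbb{R}^k\to\mathbb{R}^k$; it satisfies $\varphi(R(u))=R(\Phi(u))$ for all $u\in\mathcal{A}$. Unstable manifolds: a steady state is a point with $\Phi(u^* )=u^*$. The unstable manifold $\mathcal{W}^u_\Phi(u^* )$ is the set of points $u$ admitting a backward orbit $(u_{-j})_{j\ge0}$, $u_0=u$, $\Phi(u_{-j-1})=u_{-j}$, with $u_{-j}\to u^*$ as $j\to\infty$. A local unstable manifold $\mathcal{W}^u_{\Phi,loc}(u^* )$ is the set of points $u$ admitting such a backward orbit that remains in a fixed neighborhood of $u^*$ for all $j\ge0$. Attracting set: a compact set $K\subset Y$ is attracting if it has an open neighborhood $U_0\supset K$ (a fundamental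 neighborhood) such that for every open $V\supset K$ there is $N\in\mathbb{N}$ with $\Phi^j(U_0)\subset V$ for all $j\ge N$; its basin of attraction is then $\bigcup_{j\ge0}\Phi^{-j}(U_0)$. *)

theory Defs
  imports "HOL-Analysis.Analysis"
begin

text \<open>
  The observation space is \<^typ>\<open>real ^ 'n\<close> with \<open>k = CARD('n)\<close>. Since a finite index type carries
  no canonical order, the coordinates of a delay map are numbered by a bijection \<open>\<sigma>\<close>.
\<close>

definition delay_observation ::
  "('a::banach \<Rightarrow> 'a) \<Rightarrow> ('a \<Rightarrow> real ^ 'n::finite) \<Rightarrow> bool" where
  "delay_observation \<Phi> R \<longleftrightarrow>
     (\<exists>f \<sigma>. (\<exists>L. L-lipschitz_on UNIV (f :: 'a \<Rightarrow> real)) \<and>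
        bij_betw \<sigma> (UNIV :: 'n set) {..<CARD('n)} \<and>
        (\<forall>u i. R u $ i = f ((\<Phi> ^^ \<sigma> i) u)))"

text \<open>
  Several observables \<open>f 0, \<dots>, f (q - 1)\<close>; the observable \<open>f a\<close> is sampled along the delays
  \<open>0, \<dots>, m a - 1\<close>, so that \<open>k\<close> is the sum of the \<open>m a\<close>.
\<close>

definition multi_delay_observation ::
  "('a::banach \<Rightarrow> 'a) \<Rightarrow> ('a \<Rightarrow> real ^ 'n::finite) \<Rightarrow> bool" where
  "multi_delay_observation \<Phi> R \<longleftrightarrow>
     (\<exists>(q::nat) f m \<sigma>. (\<forall>a<q. \<exists>L. L-lipschitz_on UNIV (f a :: 'a \<Rightarrow> real)) \<and>
        bij_betw \<sigma> (UNIV :: 'n set) (SIGMA a:{..<q}. {..<m a :: nat}) \<and>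
        (\<forall>u i. R u $ i = f (fst (\<sigma> i)) ((\<Phi> ^^ snd (\<sigma> i)) u)))"

definition observation_map ::
  "('a::banach \<Rightarrow> 'a) \<Rightarrow> ('a \<Rightarrow> real ^ 'n::finite) \<Rightarrow> bool" where
  "observation_map \<Phi> R \<longleftrightarrow>
     bounded_linear R \<or> delay_observation \<Phi> R \<or> multi_delay_observation \<Phi> R"

definition core_system :: "('a \<Rightarrow> 'b) \<Rightarrow> ('a \<Rightarrow> 'a) \<Rightarrow> ('b \<Rightarrow> 'a) \<Rightarrow> 'b \<Rightarrow> 'b" where
  "core_system R \<Phi> E = R \<circ> \<Phi> \<circ> E"

text \<open>\<open>v j\<close> stands for the point \<open>u\<^bsub>-j\<^esub>\<close> of the backward orbit.\<close>

definition backward_orbit :: "('a \<Rightarrow> 'a) \<Rightarrow> (nat \<Rightarrow> 'a) \<Rightarrow> 'a \<Rightarrow> bool" where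
  "backward_orbit \<Phi> v u \<longleftrightarrow> v 0 = u \<and> (\<forall>j. \<Phi> (v (Suc j)) = v j)"

definition unstable_manifold :: "('a::topological_space \<Rightarrow> 'a) \<Rightarrow> 'a \<Rightarrow> 'a set" where
  "unstable_manifold \<Phi> p = {u. \<exists>v. backward_orbit \<Phi> v u \<and> v \<longlonglongrightarrow> p}"

text \<open>
  A local unstable manifold depends on the choice of a neighbourhood, hence it is a predicate.
  Neighbourhoods are not required to be open.
\<close>

definition is_local_unstable_manifold ::
  "('a::topological_space \<Rightarrow> 'a) \<Rightarrow> 'a \<Rightarrow> 'a set \<Rightarrow> bool" where
  "is_local_unstable_manifold \<Phi> p W \<longleftrightarrow>
     (\<exists>N. p \<in> interior N \<and>
        W = {u. \<exists>v. backward_orbit \<Phi> v u \<and> v \<longlonglongrightarrow> p \<and> (\<forall>j. v j \<in> N)})"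

definition fundamental_neighborhood ::
  "('a::topological_space \<Rightarrow> 'a) \<Rightarrow> 'a set \<Rightarrow> 'a set \<Rightarrow> bool" where
  "fundamental_neighborhood \<Phi> K U0 \<longleftrightarrow>
     open U0 \<and> K \<subseteq> U0 \<and>
     (\<forall>V. open V \<and> K \<subseteq> V \<longrightarrow> (\<exists>N. \<forall>j\<ge>N. (\<Phi> ^^ j) ` U0 \<subseteq> V))"

definition attracting_set :: "('a::topological_space \<Rightarrow> 'a) \<Rightarrow> 'a set \<Rightarrow> bool" where
  "attracting_set \<Phi> K \<longleftrightarrow> compact K \<and> (\<exists>U0. fundamental_neighborhood \<Phi> K U0)"

text \<open>
  The union below does not depend on the fundamental neighbourhood: each one is mapped
  into any other by all sufficiently high iterates.
\<close>

definition is_basin_of_attraction ::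
  "('a::topological_space \<Rightarrow> 'a) \<Rightarrow> 'a set \<Rightarrow> 'a set \<Rightarrow> bool" where
  "is_basin_of_attraction \<Phi> K U \<longleftrightarrow>
     (\<exists>U0. fundamental_neighborhood \<Phi> K U0 \<and> U = (\<Union>j. (\<Phi> ^^ j) -` U0))"

definition relative_attractor :: "('b \<Rightarrow> 'b) \<Rightarrow> 'b set \<Rightarrow> 'b set" where
  "relative_attractor \<phi> C = (\<Inter>j. (\<phi> ^^ j) ` C)"

definition neighborhood_in :: "'b::topological_space set \<Rightarrow> 'b \<Rightarrow> 'b set \<Rightarrow> bool" where
  "neighborhood_in S p C \<longleftrightarrow>
     C \<subseteq> S \<and> (\<exists>T. openin (top_of_set S) T \<and> p \<in> T \<and> T \<subseteq> C)"

end

theory Submission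
  imports Defs
begin

text \<open>
  The map \<open>R\<close> conjugates \<open>\<Phi>\<close> on \<open>\<A>\<close> to \<open>\<phi>\<close>. Shifting backward orbits gives
  \<open>W \<subseteq> \<Phi> ` W\<close> for a local unstable manifold \<open>W\<close>, and by compactness its closure is contained in
  all of its forward images, which yields the inclusion into \<open>A\<^sub>C\<close>. Conversely, injectivity of
  \<open>R\<close> lifts a point of \<open>A\<^sub>C\<close> to a point of \<open>\<Inter>j. \<Phi>\<^sup>j (E ` C)\<close>. The compact set \<open>E ` C\<close> lies in
  the basin, hence enters every neighbourhood of the attracting closed set in uniform finite
  time, so that intersection is contained in the attracting set.
\<close>

lemma continuous_on_funpow:
  fixes f :: "'a::topological_space \<Rightarrow> 'a"
  assumes "continuous_on UNIV f"
  shows "continuous_on UNIV (f ^^ n)"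
proof (induction n)
  case (Suc n)
  then show ?case
    using continuous_on_compose[OF Suc continuous_on_subset[OF assms subset_UNIV]]
    by simp
qed (simp add: id_def)

text \<open>Dropping the endpoint of a backward orbit of \<open>u\<close> leaves a backward orbit of
  a preimage of \<open>u\<close>, with the same limit and inside the same \<open>N\<close>.\<close>

lemma local_unstable_manifold_subset_image:
  assumes "is_local_unstable_manifold \<Phi> p W"
  shows "W \<subseteq> \<Phi> ` W"
proof
  obtain N where W: "W = {u. \<exists>v. backward_orbit \<Phi> v u \<and> v \<longlonglongrightarrow> p \<and> (\<forall>j. v j \<in> N)}"
    using assms unfolding is_local_unstable_manifold_def by blast
  fix u assume "u \<in> W"
  then obtain v where v: "backward_orbit \<Phi> v u" "v \<longlonglongrightarrow> p" "\<forall>j. v j \<in> N"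
    unfolding W by blast
  have "backward_orbit \<Phi> (\<lambda>j. v (Suc j)) (v (Suc 0))"
    using v(1) by (simp add: backward_orbit_def)
  moreover have "(\<lambda>j. v (Suc j)) \<longlonglongrightarrow> p"
    using v(2) by (rule LIMSEQ_Suc)
  ultimately have "v (Suc 0) \<in> W"
    unfolding W using v(3) by blast
  moreover have "u = \<Phi> (v (Suc 0))"
    using v(1) by (simp add: backward_orbit_def)
  ultimately show "u \<in> \<Phi> ` W" by blast
qed

lemma subset_funpow_image:
  assumes "W \<subseteq> f ` W"
  shows "W \<subseteq> (f ^^ n) ` W"
proof (induction n)
  case (Suc n)
  then have "f ` W \<subseteq> (f ^^ Suc n) ` W" by (auto simp: image_comp [symmetric])
  with assms show ?case by blast
qed simp

text \<open>The iterate maps the compact closure onto a compact set, which is closed in a Hausdorff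
  space and therefore contains the closure of \<open>W\<close> once it contains
  \<open>W\<close>.\<close>

lemma closure_subset_funpow_image:
  fixes f :: "'a::t2_space \<Rightarrow> 'a"
  assumes f: "continuous_on UNIV f" and W: "W \<subseteq> f ` W" and K: "compact (closure W)"
  shows "closure W \<subseteq> (f ^^ n) ` closure W"
proof (rule closure_minimal)
  show "W \<subseteq> (f ^^ n) ` closure W"
    using subset_funpow_image[OF W, of n] closure_subset by blast
  show "closed ((f ^^ n) ` closure W)"
    by (meson K compact_continuous_image compact_imp_closed continuous_on_funpow
        continuous_on_subset f subset_UNIV)
qed

text \<open>By compactness, finitely many of the open preimages of \<open>U0\<close> already cover
  \<open>D\<close>, so the times at which points of \<open>D\<close> visit \<open>U0\<close> can be
  chosen bounded.\<close>

lemma funpow_image_compact_subset_neighborhood: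
  fixes \<Phi> :: "'a::topological_space \<Rightarrow> 'a"
  assumes cont: "continuous_on UNIV \<Phi>"
    and basin: "is_basin_of_attraction \<Phi> K U"
    and D: "compact D" "D \<subseteq> U" and V: "open V" "K \<subseteq> V"
  shows "\<exists>n. (\<Phi> ^^ n) ` D \<subseteq> V"
proof -
  obtain U0 where U0: "fundamental_neighborhood \<Phi> K U0" and U: "U = (\<Union>j. (\<Phi> ^^ j) -` U0)"
    using basin unfolding is_basin_of_attraction_def by blast
  obtain N where N: "\<And>j. j \<ge> N \<Longrightarrow> (\<Phi> ^^ j) ` U0 \<subseteq> V"
    using U0 V unfolding fundamental_neighborhood_def by blast
  have "open ((\<Phi> ^^ j) -` U0)" for j
    using U0 open_vimage[OF _ continuous_on_funpow[OF cont]]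
    unfolding fundamental_neighborhood_def by blast
  moreover have "D \<subseteq> (\<Union>j\<in>UNIV. (\<Phi> ^^ j) -` U0)"
    using D(2) unfolding U .
  ultimately obtain J where J: "finite J" "D \<subseteq> (\<Union>j\<in>J. (\<Phi> ^^ j) -` U0)"
    using compactE_image[OF D(1)] by (metis (no_types, lifting))
  obtain M where M: "\<forall>j\<in>J. j \<le> M"
    using J(1) finite_nat_set_iff_bounded_le by blast
  \<comment> \<open>\<open>j\<close> steps lead from \<open>d\<close> into \<open>U0\<close>; since
    \<open>j\<close> is at most \<open>M\<close>, at least \<open>N\<close> steps remain, enough to
    carry all of \<open>U0\<close> into \<open>V\<close>.\<close>
  have "(\<Phi> ^^ (M + N)) d \<in> V" if d: "d \<in> D" for d
  proof -
    obtain j where j: "j \<in> J" "(\<Phi> ^^ j) d \<in> U0"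
      using J(2) d by blast
    have "M + N = (M + N - j) + j" "N \<le> M + N - j"
      using M j(1) by auto
    then have "(\<Phi> ^^ (M + N)) d = (\<Phi> ^^ (M + N - j)) ((\<Phi> ^^ j) d)"
      by (metis comp_apply funpow_add)
    with N[OF \<open>N \<le> M + N - j\<close>] j(2) show ?thesis by auto
  qed
  then show ?thesis by blast
qed

text \<open>If \<open>u\<close> is outside \<open>K\<close>, its complement is an open neighborhood
  of \<open>K\<close>, so some iterate of \<open>D\<close> misses \<open>u\<close>.\<close>

lemma Inter_funpow_image_subset_attracting:
  fixes \<Phi> :: "'a::t1_space \<Rightarrow> 'a"
  assumes "continuous_on UNIV \<Phi>" "is_basin_of_attraction \<Phi> K U" "compact D" "D \<subseteq> U"
  shows "(\<Inter>j. (\<Phi> ^^ j) ` D) \<subseteq> K"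
proof
  fix u assume u: "u \<in> (\<Inter>j. (\<Phi> ^^ j) ` D)"
  show "u \<in> K"
  proof (rule ccontr)
    assume "u \<notin> K"
    then obtain n where "(\<Phi> ^^ n) ` D \<subseteq> - {u}"
      using funpow_image_compact_subset_neighborhood[OF assms, of "- {u}"]
      by (auto simp: open_Compl)
    with u show False by blast
  qed
qed

lemma funpow_in_invariant:
  assumes "f ` A \<subseteq> A" "u \<in> A"
  shows "(f ^^ n) u \<in> A"
  using assms by (induction n) auto

text \<open>The orbit of \<open>u\<close> stays in \<open>A\<close>, where \<open>E\<close> undoes
  \<open>R\<close>, so the inner factors cancel at each step.\<close>

lemma funpow_core_system:
  assumes "\<Phi> ` A \<subseteq> A" "\<And>u. u \<in> A \<Longrightarrow> E (R u) = u" "u \<in> A"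
  shows "(core_system R \<Phi> E ^^ n) (R u) = R ((\<Phi> ^^ n) u)"
proof (induction n)
  case (Suc n)
  with assms funpow_in_invariant[OF assms(1,3), of n] show ?case
    by (simp add: core_system_def)
qed simp

theorem proposition4:
  fixes \<Phi> :: "'a::banach \<Rightarrow> 'a"
    and \<A> W\<^sub>l\<^sub>o\<^sub>c :: "'a set"
    and R :: "'a \<Rightarrow> real ^ 'n::finite"
    and E\<^sub>0 E :: "real ^ 'n \<Rightarrow> 'a"
    and u\<^sub>s :: 'a
  assumes "\<exists>L. L-lipschitz_on UNIV \<Phi>"
    and "compact \<A>" and "\<Phi> ` \<A> = \<A>"
    and "observation_map \<Phi> R" and "inj_on R \<A>"
    and "continuous_on (R ` \<A>) E\<^sub>0"
    and "\<forall>u\<in>\<A>. E\<^sub>0 (R u) = u" and "\<forall>x\<in>R ` \<A>. R (E\<^sub>0 x) = x"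
    and "continuous_on UNIV E" and "\<forall>x\<in>R ` \<A>. E x = E\<^sub>0 x"
    and "u\<^sub>s \<in> \<A>" and "\<Phi> u\<^sub>s = u\<^sub>s"
    and "unstable_manifold \<Phi> u\<^sub>s \<subseteq> \<A>"
    and "is_local_unstable_manifold \<Phi> u\<^sub>s W\<^sub>l\<^sub>o\<^sub>c" and "W\<^sub>l\<^sub>o\<^sub>c \<subseteq> \<A>"
  shows
    "(\<forall>C. compact C \<and> neighborhood_in (R ` \<A>) (R u\<^sub>s) C \<and> R ` closure W\<^sub>l\<^sub>o\<^sub>c \<subseteq> C \<longrightarrow>
        R ` closure W\<^sub>l\<^sub>o\<^sub>c \<subseteq> relative_attractor (core_system R \<Phi> E) C) \<and>
     (\<forall>U C. attracting_set \<Phi> (closure W\<^sub>l\<^sub>o\<^sub>c) \<and> is_basin_of_attraction \<Phi> (closure W\<^sub>l\<^sub>o\<^sub>c) U \<and>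
        closure W\<^sub>l\<^sub>o\<^sub>c \<subseteq> U \<and> compact C \<and> R ` closure W\<^sub>l\<^sub>o\<^sub>c \<subseteq> C \<and> C \<subseteq> R ` \<A> \<and> E ` C \<subseteq> U \<longrightarrow>
        R ` closure W\<^sub>l\<^sub>o\<^sub>c = relative_attractor (core_system R \<Phi> E) C)"
proof -
  let ?\<phi> = "core_system R \<Phi> E"
  let ?K = "closure W\<^sub>l\<^sub>o\<^sub>c"
  have cont: "continuous_on UNIV \<Phi>"
    using assms(1) lipschitz_on_continuous_on by blast
  have K: "?K \<subseteq> \<A>"
    using assms(2,15) by (simp add: closure_minimal compact_imp_closed)
  then have "compact ?K"
    using compact_Int_closed[OF assms(2) closed_closure] by (metis inf.absorb2)
  then have K_iter: "?K \<subseteq> (\<Phi> ^^ j) ` ?K" for j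
    using closure_subset_funpow_image[OF cont local_unstable_manifold_subset_image[OF assms(14)]]
    by blast
  have inv: "\<Phi> ` \<A> \<subseteq> \<A>"
    using assms(3) by simp
  have ER: "E (R u) = u" if "u \<in> \<A>" for u
    using that assms(7,10) by simp
  have conj: "(?\<phi> ^^ j) (R u) = R ((\<Phi> ^^ j) u)" if "u \<in> \<A>" for u j
    using inv ER that by (rule funpow_core_system)
  \<comment> \<open>This gives (a) and one inclusion of (b).\<close>
  have sub: "R ` ?K \<subseteq> relative_attractor ?\<phi> C" if C: "R ` ?K \<subseteq> C" for C
    unfolding relative_attractor_def
  proof (intro subsetI INT_I)
    fix x j assume "x \<in> R ` ?K"
    then obtain w where w: "w \<in> ?K" "x = R ((\<Phi> ^^ j) w)"
      using K_iter[of j] by blast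
    then have "x = (?\<phi> ^^ j) (R w)"
      using conj K by (metis subsetD)
    then show "x \<in> (?\<phi> ^^ j) ` C"
      using w(1) C by blast
  qed
  have sup: "relative_attractor ?\<phi> C \<subseteq> R ` ?K"
    if basin: "is_basin_of_attraction \<Phi> ?K U"
      and C: "compact C" "C \<subseteq> R ` \<A>" "E ` C \<subseteq> U" for U C
  proof
    fix x assume x: "x \<in> relative_attractor ?\<phi> C"
    \<comment> \<open>The preimage \<open>c\<close> varies with \<open>j\<close>, but the lift
      \<open>E x\<close> is one fixed point, so it lies in the intersection over all
      \<open>j\<close>.\<close>
    have "E x \<in> (\<Phi> ^^ j) ` E ` C" for j
    proof -
      obtain c where c: "c \<in> C" "x = (?\<phi> ^^ j) c"
        using x unfolding relative_attractor_def by blast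
      then obtain d where d: "d \<in> \<A>" "c = R d"
        using C(2) by blast
      then have "x = R ((\<Phi> ^^ j) d)"
        using conj c(2) by simp
      then have "E x = (\<Phi> ^^ j) (E c)"
        using ER funpow_in_invariant[OF inv d(1)] d by simp
      with c(1) show ?thesis by blast
    qed
    moreover have "compact (E ` C)"
      using C(1) assms(9) by (meson compact_continuous_image continuous_on_subset subset_UNIV)
    ultimately have "E x \<in> ?K"
      using Inter_funpow_image_subset_attracting[OF cont basin _ C(3)] by blast
    \<comment> \<open>The index 0 places \<open>x\<close> itself in \<open>C\<close>, hence in the
      image of \<A> under \<open>R\<close>, where \<open>E\<close> is a right inverse of
      \<open>R\<close>.\<close>
    moreover have "x \<in> (?\<phi> ^^ 0) ` C"
      using x unfolding relative_attractor_def by blast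
    then have "R (E x) = x"
      using C(2) assms(8,10) by auto
    ultimately show "x \<in> R ` ?K"
      by (metis imageI)
  qed
  show ?thesis
    by (intro conjI allI impI subset_antisym; elim conjE) (rule sub sup; assumption)+
qed

end
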